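(* Let $m\ge 3$. Then $$\mathcal{G}(\mathcal{D}_m) = \mathrm{mex}\{x_3,x_4,\dots,x_{m-2}\},$$ where $x_i=\mathcal{G}(\mathcal{H}_i)\oplus\mathcal{G}(\mathcal{D}_{m+1-i})$ for $i \in \{3,4,\dots,m-2\}$.
   Context: Toggle: Let $G$ be a finite simple graph, with $N[v]$ the closed neighborhood of $v$. A position $\{G,V_0\}$ consists of $G$ and a set $V_0\subseteq V(G)$ of vertices of weight $0$; all other vertices have weight $1$. Let $\sigma(v)$ be the sum of the weights of the vertices in $N[v]$. A legal move consists of choosing a vertex $v$ of weight $1$ and switching the weight ($0\leftrightarrow 1$) of every vertex of $N[v]$; it is allowed only if $\sigma(v)$ after the switch is strictly smaller than $\sigma(v)$ before it. Two players alternate legal moves; a player with no legal move loses. Nimbers: $\mathcal{G}(\mathcal{S})=\mathrm{mex}\{\mathcal{G}(\mathcal{S}') : \mathcal{S}' \text{ reachable from } \mathcal{S} \text{ by one legal move}\}$, where $\mathrm{mex}(T)$ is the least nonnegative integer not in the finite set $T$ (so $\mathrm{mex}(\emptyset)=0$; lists with upper index less than $3$ are empty). $\oplus$ denotes bitwise XOR of nonnegative integers. $\mathcal{L}_{2,m}$ is the $2\times m$ grid graph with vertices $v_{i,j}$, $0\le i\le 1$, $1\le j\le m$, with edges $v_{0,j}v_{1,j}$ and $v_{i,j}v_{i,j+1}$ ($1\le j<m$). For $m\ge 4$, $\mathcal{H}_m=\{\mathcal{L}_{2,m},V_0\}$ with $V_0=\{v_{0,1},v_{0,m},v_{1,1},v_{1,2},v_{1,m-1},v_{1,m}\}$;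 $\mathcal{H}_3=\{\mathcal{L}_{2,3},V_0\}$ with $V_0=\{v_{0,1},v_{0,3},v_{1,1},v_{1,3}\}$. For $m\ge 3$, $\mathcal{D}_m=\{\mathcal{L}_{2,m},V_0\}$ with $V_0=\{v_{0,1},v_{0,m-1},v_{0,m},v_{1,1},v_{1,2},v_{1,m}\}$. *)

theory Defs
  imports Main
begin

unbundle bit_operations_syntax

definition simple_graph :: "'a set \<Rightarrow> 'a set set \<Rightarrow> bool" where
  "simple_graph V E \<longleftrightarrow>
     finite V \<and> (\<forall>e\<in>E. \<exists>u v. e = {u, v} \<and> u \<noteq> v \<and> u \<in> V \<and> v \<in> V)"

record 'a position =
  verts :: "'a set"
  edges :: "'a set set"
  zeros :: "'a set"

definition toggle_position :: "'a position \<Rightarrow> bool" where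
  "toggle_position S \<longleftrightarrow> simple_graph (verts S) (edges S) \<and> zeros S \<subseteq> verts S"

definition closed_nbhd :: "'a position \<Rightarrow> 'a \<Rightarrow> 'a set" where
  "closed_nbhd S v = {u \<in> verts S. u = v \<or> {u, v} \<in> edges S}"

definition weight :: "'a position \<Rightarrow> 'a \<Rightarrow> nat" where
  "weight S v = (if v \<in> zeros S then 0 else 1)"

definition sigma :: "'a position \<Rightarrow> 'a \<Rightarrow> nat" where
  "sigma S v = (\<Sum>u\<in>closed_nbhd S v. weight S u)"

definition switch :: "'a position \<Rightarrow> 'a \<Rightarrow> 'a position" where
  "switch S v = S\<lparr>zeros := (zeros S - closed_nbhd S v) \<union> (closed_nbhd S v - zeros S)\<rparr>"

definition legal_move :: "'a position \<Rightarrow> 'a \<Rightarrow> bool" where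
  "legal_move S v \<longleftrightarrow>
     v \<in> verts S \<and> weight S v = 1 \<and> sigma (switch S v) v < sigma S v"

definition followers :: "'a position \<Rightarrow> 'a position set" where
  "followers S = {switch S v | v. legal_move S v}"

definition mex :: "nat set \<Rightarrow> nat" where
  "mex T = (LEAST n. n \<notin> T)"

lemma closed_nbhd_switch [simp]: "closed_nbhd (switch S v) = closed_nbhd S"
  by (rule ext) (simp add: closed_nbhd_def switch_def)

lemma verts_switch [simp]: "verts (switch S v) = verts S"
  by (simp add: switch_def)

lemma edges_switch [simp]: "edges (switch S v) = edges S"
  by (simp add: switch_def)

lemma toggle_position_switch:
  "toggle_position S \<Longrightarrow> toggle_position (switch S v)"
  by (auto simp: toggle_position_def closed_nbhd_def switch_def)

lemma total_weight_decreases: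
  assumes "finite (verts S)" and "legal_move S v"
  shows "(\<Sum>u\<in>verts S. weight (switch S v) u) < (\<Sum>u\<in>verts S. weight S u)"
proof -
  let ?N = "closed_nbhd S v"
  have sub: "?N \<subseteq> verts S"
    by (auto simp: closed_nbhd_def)
  have split: "(\<Sum>u\<in>verts S. f u) = (\<Sum>u\<in>verts S - ?N. f u) + (\<Sum>u\<in>?N. f u)"
    for f :: "'a \<Rightarrow> nat"
    using sum.subset_diff[OF sub assms(1)] .
  have "(\<Sum>u\<in>verts S - ?N. weight (switch S v) u) = (\<Sum>u\<in>verts S - ?N. weight S u)"
    by (rule sum.cong) (auto simp: weight_def switch_def)
  moreover have "(\<Sum>u\<in>?N. weight (switch S v) u) < (\<Sum>u\<in>?N. weight S u)"
    using assms(2) by (simp add: legal_move_def sigma_def)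
  ultimately show ?thesis
    by (simp add: split)
qed

(* The guard is needed only because the recursion can fail to terminate on infinite graphs. *)
function grundy :: "'a position \<Rightarrow> nat" where
  "grundy S = (if toggle_position S then mex (grundy ` followers S) else undefined)"
  by pat_completeness auto
termination
  by (relation "measure (\<lambda>S. \<Sum>u\<in>verts S. weight S u)")
     (auto simp: followers_def toggle_position_def simple_graph_def
           intro: total_weight_decreases)

declare grundy.simps [simp del]

definition grid_verts :: "nat \<Rightarrow> (nat \<times> nat) set" where
  "grid_verts m = {(i, j). i \<le> 1 \<and> 1 \<le> j \<and> j \<le> m}"

definition grid_edges :: "nat \<Rightarrow> (nat \<times> nat) set set" where
  "grid_edges m =
     {{(0, j), (1, j)} | j. 1 \<le> j \<and> j \<le> m} \<union>
     {{(i, j), (i, j + 1)} | i j. i \<le> 1 \<and> 1 \<le> j \<and> j < m}"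

definition grid_position :: "nat \<Rightarrow> (nat \<times> nat) set \<Rightarrow> (nat \<times> nat) position" where
  "grid_position m V0 = \<lparr>verts = grid_verts m, edges = grid_edges m, zeros = V0\<rparr>"

(* Only meaningful for m >= 3. *)
definition H :: "nat \<Rightarrow> (nat \<times> nat) position" where
  "H m = grid_position m
     (if m = 3 then {(0, 1), (0, 3), (1, 1), (1, 3)}
      else {(0, 1), (0, m), (1, 1), (1, 2), (1, m - 1), (1, m)})"

(* Only meaningful for m >= 3. *)
definition D :: "nat \<Rightarrow> (nat \<times> nat) position" where
  "D m = grid_position m {(0, 1), (0, m - 1), (0, m), (1, 1), (1, 2), (1, m)}"

lemma simple_graph_grid: "simple_graph (grid_verts m) (grid_edges m)"
proof -
  have "grid_verts m \<subseteq> {..1} \<times> {..m}"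
    by (auto simp: grid_verts_def)
  then have "finite (grid_verts m)"
    by (rule finite_subset) simp
  moreover have "\<exists>u v. e = {u, v} \<and> u \<noteq> v \<and> u \<in> grid_verts m \<and> v \<in> grid_verts m"
    if "e \<in> grid_edges m" for e
    using that unfolding grid_edges_def grid_verts_def by fastforce
  ultimately show ?thesis
    by (simp add: simple_graph_def)
qed

lemma toggle_position_H: "m \<ge> 3 \<Longrightarrow> toggle_position (H m)"
  using simple_graph_grid[of m]
  by (auto simp: toggle_position_def H_def grid_position_def grid_verts_def)

lemma toggle_position_D: "m \<ge> 3 \<Longrightarrow> toggle_position (D m)"
  using simple_graph_grid[of m]
  by (auto simp: toggle_position_def D_def grid_position_def grid_verts_def)

end

theory Submission
  imports Defs
begin

text \<open>
  In every reachable position the vertices of weight 1 lie in blocks separated by columns of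
  weight 0. A block is determined by its two bounding columns and by the row that sticks out at
  each end: the same row at both ends is \<open>H\<close> up to symmetry, opposite rows give \<open>D\<close>. A legal move
  creates one new zero column and cuts its block into two blocks meeting there. It never switches
  a separating column, so the blocks do not interact and the nimber is the XOR of the block
  nimbers. The latter follows by induction on decompositions, without a notion of a sum of games.
\<close>

section \<open>Mex and XOR of natural numbers\<close>

lemma mex_notin: "finite T \<Longrightarrow> mex T \<notin> T"
  unfolding mex_def using ex_new_if_finite[OF infinite_UNIV_nat] by (metis LeastI_ex)

lemma less_mexD: "n < mex T \<Longrightarrow> n \<in> T"
  unfolding mex_def using not_less_Least by blast

lemma mex_eqI: "g \<notin> T \<Longrightarrow> (\<And>n. n < g \<Longrightarrow> n \<in> T) \<Longrightarrow> mex T = g"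
  unfolding mex_def by (rule Least_equality) (auto simp: not_less[symmetric])

text \<open>The arithmetic behind optimal play in a sum: a target below \<open>a XOR b\<close> is
  reached by lowering one component. Binary induction: either the halves already decide, or only the
  lowest bit does.\<close>

lemma less_xor_cases:
  fixes a b n :: nat
  assumes "n < a XOR b"
  shows "n XOR b < a \<or> n XOR a < b"
  using assms
proof (induction n arbitrary: a b rule: less_induct)
  case (less n)
  have div2: "(x XOR y) div 2 = (x div 2) XOR (y div 2)" for x y :: nat
    using drop_bit_xor[of 1 x y] by (simp add: drop_bit_eq_div)
  have lt_div2: "x < y" if "x div 2 < y div 2" for x y :: nat
    using that by linarith
  have lt_parity: "x < y" if "x div 2 = y div 2" "even x" "odd y" for x y :: nat
    using that by presburger
  show ?case
  proof (cases "n div 2 < (a div 2) XOR (b div 2)")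
    case True
    have "(n div 2) XOR (b div 2) < a div 2 \<or> (n div 2) XOR (a div 2) < b div 2"
    proof (cases "n = 0")
      case True
      then show ?thesis
        using \<open>n div 2 < (a div 2) XOR (b div 2)\<close>
        by (cases "a div 2" "b div 2" rule: linorder_cases) auto
    next
      case False
      then show ?thesis using less.IH[OF _ True] by simp
    qed
    then show ?thesis
      using lt_div2 by (metis div2)
  next
    case False
    \<comment> \<open>Exactly one of \<open>a\<close> and \<open>b\<close> is odd; clearing its last
      bit lowers it.\<close>
    then have eq: "n div 2 = (a div 2) XOR (b div 2)" and parity: "even n" "odd (a XOR b)"
      using less.prems div2[of a b] by presburger+
    have "(n XOR b) div 2 = a div 2" "(n XOR a) div 2 = b div 2"
      unfolding div2 eq by (metis xor.assoc xor.commute xor_self_eq xor.right_neutral)+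
    then show ?thesis
      using parity lt_parity[of "n XOR b" a] lt_parity[of "n XOR a" b] by (auto simp: even_xor_iff)
  qed
qed

section \<open>Moves and blocks on an unbounded two-row strip\<close>

definition strip_nbhd :: "nat \<times> nat \<Rightarrow> (nat \<times> nat) set" where
  "strip_nbhd = (\<lambda>(i, j). {(i, j), (1 - i, j), (i, j - 1), (i, j + 1)})"

text \<open>
  \<open>W\<close> is the set of vertices of weight 1. Away from the end columns a closed neighborhood has four
  vertices, so a move is legal iff at least three of them have weight 1.
\<close>

definition strip_move :: "(nat \<times> nat) set \<Rightarrow> nat \<times> nat \<Rightarrow> bool" where
  "strip_move W = (\<lambda>(i, j). (i, j) \<in> W \<and>
     ((1 - i, j) \<in> W \<and> (i, j - 1) \<in> W \<or> (1 - i, j) \<in> W \<and> (i, j + 1) \<in> W \<or>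
      (i, j - 1) \<in> W \<and> (i, j + 1) \<in> W))"

definition strip_switch :: "(nat \<times> nat) set \<Rightarrow> nat \<times> nat \<Rightarrow> (nat \<times> nat) set" where
  "strip_switch W v = (W - strip_nbhd v) \<union> (strip_nbhd v - W)"

text \<open>
  Row \<open>s\<close> sticks out at the left end, row \<open>t\<close> at the right end. The exceptional clause is the shape
  of \<open>H 3\<close>, which does not follow the general pattern of \<open>H m\<close>.
\<close>

definition piece :: "nat \<Rightarrow> nat \<Rightarrow> nat \<Rightarrow> nat \<Rightarrow> (nat \<times> nat) set" where
  "piece s t a b = {(i, j). i \<le> 1 \<and>
     (if b = a + 2 \<and> s = t then j = a + 1
      else a + (if i = s then 1 else 2) \<le> j \<and> j + (if i = t then 1 else 2) \<le> b)}"

text \<open>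
  The flag \<open>e\<close> says whether the same row sticks out at both ends of a block with \<open>n\<close> columns,
  bounding columns included. A move in row \<open>1 - r\<close> and column \<open>i\<close> of the block makes row \<open>r\<close> stick out
  on both sides of the new zero column; \<open>f\<close> says whether \<open>r\<close> is also the row at the left end.
\<close>

function piece_value :: "bool \<Rightarrow> nat \<Rightarrow> nat" where
  "piece_value e n = mex ((\<lambda>(f, i). piece_value f i XOR piece_value (e = f) (n + 1 - i))
     ` (UNIV \<times> {3..n - 2}))"
  by pat_completeness auto
termination by (relation "measure snd") auto

declare piece_value.simps [simp del]

text \<open>Adjacent blocks share the zero column \<open>c\<close>. Carrying the candidate nimber as
  an index lets both mex conditions be proved by induction on the derivation.\<close>

inductive decomposes :: "nat \<Rightarrow> nat \<Rightarrow> (nat \<times> nat) set \<Rightarrow> nat \<Rightarrow> bool" where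
  piece: "\<lbrakk>a + 2 \<le> b; s \<le> 1; t \<le> 1\<rbrakk> \<Longrightarrow>
    decomposes a b (piece s t a b) (piece_value (s = t) (b + 1 - a))"
| join: "\<lbrakk>decomposes a c W g; decomposes c b W' g'\<rbrakk> \<Longrightarrow> decomposes a b (W \<union> W') (g XOR g')"

lemma decomposes_bounds:
  "decomposes a b W g \<Longrightarrow> a < b \<and> W \<subseteq> {..1} \<times> {a<..<b}"
  by (induction rule: decomposes.induct)
     (auto simp: piece_def split: if_splits)

text \<open>The excluded case is \<open>H 5\<close>, where only the middle vertex of one row can be played.\<close>

lemma piece_switch:
  assumes "s \<le> 1" "t \<le> 1" "r \<le> 1" "a + 2 \<le> j" "j + 2 \<le> b" "\<not> (b = a + 4 \<and> s = t \<and> r = s)"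
  shows "strip_move (piece s t a b) (1 - r, j)"
    and "strip_switch (piece s t a b) (1 - r, j) = piece s r a j \<union> piece r t j b"
proof -
  obtain k l where j: "j = a + 2 + k" and b: "b = j + 2 + l"
    using assms(4,5) le_Suc_ex by metis
  have rows: "s = 0 \<or> s = 1" "t = 0 \<or> t = 1" "r = 0 \<or> r = 1"
    using assms(1-3) by auto
  show "strip_move (piece s t a b) (1 - r, j)"
    using rows assms(6) unfolding strip_move_def piece_def b j by auto
  show "strip_switch (piece s t a b) (1 - r, j) = piece s r a j \<union> piece r t j b"
  proof (intro set_eqI)
    fix p :: "nat \<times> nat"
    obtain x y where p: "p = (x, y)" by fastforce
    have "x = 0 \<or> x = 1 \<or> x > 1" by auto
    \<comment> \<open>Only columns \<open>j - 1\<close> to \<open>j + 1\<close> can change;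
      \<open>k = 0\<close> or \<open>l = 0\<close> means that a new block has three columns, where
      the exceptional clause of \<open>piece\<close> may apply.\<close>
    moreover have "y + 2 \<le> j \<or> y + 1 = j \<or> y = j \<or> y = j + 1 \<or> j + 2 \<le> y" by auto
    ultimately show "p \<in> strip_switch (piece s t a b) (1 - r, j) \<longleftrightarrow> p \<in> piece s r a j \<union> piece r t j b"
      using rows assms(6) unfolding strip_switch_def strip_nbhd_def piece_def b j p
      by (elim disjE; cases "k = 0"; cases "l = 0") simp_all
  qed
qed

text \<open>Converse of \<open>piece_switch\<close>: next to a bounding column, a vertex of weight 1
  has at most one neighbor of weight 1, so every legal move is a cut further inside.\<close>

lemma piece_moveD:
  assumes "s \<le> 1" "t \<le> 1" "a + 2 \<le> b" "strip_move (piece s t a b) (i, j)"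
  shows "i \<le> 1" "a + 2 \<le> j" "j + 2 \<le> b" "\<not> (b = a + 4 \<and> s = t \<and> 1 - i = s)"
proof -
  have rows: "s = 0 \<or> s = 1" "t = 0 \<or> t = 1"
    using assms(1,2) by auto
  show "i \<le> 1"
    using assms(4) by (auto simp: strip_move_def piece_def)
  then have "i = 0 \<or> i = 1" by auto
  then show "a + 2 \<le> j" "j + 2 \<le> b" "\<not> (b = a + 4 \<and> s = t \<and> 1 - i = s)"
    using rows assms(3,4) unfolding strip_move_def piece_def
    by (auto split: if_splits)
qed

lemma strip_move_Un:
  "strip_move W v \<Longrightarrow> strip_move (W \<union> W') v"
  by (auto simp: strip_move_def)

text \<open>Column \<open>c\<close> has weight 0, so a vertex on one side gets no support from the
  other.\<close>

lemma strip_move_UnD: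
  assumes "strip_move (W \<union> W') v" "W \<subseteq> {..1} \<times> {a<..<c}" "W' \<subseteq> {..1} \<times> {c<..<b}"
  shows "strip_move W v \<or> strip_move W' v"
proof -
  obtain i j where v: "v = (i, j)" by fastforce
  have "(x, y) \<notin> W" if "c \<le> y" for x y using that assms(2) by auto
  moreover have "(x, y) \<notin> W'" if "y \<le> c" for x y using that assms(3) by auto
  moreover have "j < c \<or> c < j" using assms by (auto simp: v strip_move_def)
  ultimately show ?thesis
    using assms(1) unfolding strip_move_def v by auto
qed

text \<open>The two disjointness conditions together keep \<open>W'\<close> out of the neighborhood
  of \<open>v\<close>.\<close>

lemma strip_switch_Un:
  assumes "strip_switch W v \<inter> W' = {}" "W \<inter> W' = {}"
  shows "strip_switch (W \<union> W') v = strip_switch W v \<union> W'"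
  using assms unfolding strip_switch_def by blast

lemma decomposes_join_switch:
  assumes "decomposes a c W g" "decomposes c b W' g'"
  shows "decomposes a c (strip_switch W v) h \<Longrightarrow>
      decomposes a b (strip_switch (W \<union> W') v) (h XOR g')"
    and "decomposes c b (strip_switch W' v) h \<Longrightarrow>
      decomposes a b (strip_switch (W \<union> W') v) (g XOR h)"
proof -
  have disj: "U \<inter> U' = {}" if "decomposes a c U x" "decomposes c b U' y" for U U' x y
    using decomposes_bounds[OF that(1)] decomposes_bounds[OF that(2)] by fastforce
  show "decomposes a b (strip_switch (W \<union> W') v) (h XOR g')"
    if h: "decomposes a c (strip_switch W v) h"
    using decomposes.join[OF h assms(2)] strip_switch_Un[OF disj[OF h assms(2)] disj[OF assms]]
    by simp
  show "decomposes a b (strip_switch (W \<union> W') v) (g XOR h)"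
    if h: "decomposes c b (strip_switch W' v) h"
    using decomposes.join[OF assms(1) h] strip_switch_Un[of W' v W] disj[OF assms(1) h] disj[OF assms]
    by (simp add: Un_commute Int_commute)
qed

lemma decomposes_cut_piece:
  assumes "s \<le> 1" "t \<le> 1" "r \<le> 1" "a + 2 \<le> j" "j + 2 \<le> b" "\<not> (b = a + 4 \<and> s = t \<and> r = s)"
  shows "decomposes a b (strip_switch (piece s t a b) (1 - r, j))
    (piece_value (s = r) (j + 1 - a) XOR piece_value (r = t) (b + 1 - j))"
  unfolding piece_switch(2)[OF assms]
  by (intro decomposes.join[where c = j] decomposes.piece assms(1-5))

section \<open>The two mex conditions for decompositions\<close>

lemma finite_piece_followers:
  "finite ((\<lambda>(f, i). piece_value f i XOR piece_value (e = f) (n + 1 - i)) ` (UNIV \<times> {3..n - 2}))"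
  by simp

text \<open>No move keeps the value: a cut has a value in the set whose mex is taken, and XOR with
  the untouched part is injective.\<close>

lemma decomposes_moveD:
  assumes "decomposes a b W g" "strip_move W v"
  shows "\<exists>g'. decomposes a b (strip_switch W v) g' \<and> g' \<noteq> g"
  using assms
proof (induction arbitrary: v rule: decomposes.induct)
  case (piece a b s t)
  obtain i j where v: "v = (i, j)" by fastforce
  note D = piece_moveD[OF piece(2,3,1) piece(4)[unfolded v]]
  let ?r = "1 - i" and ?k = "j + 1 - a"
  let ?g = "piece_value (s = ?r) ?k XOR piece_value (?r = t) (b + 1 - j)"
  have "decomposes a b (strip_switch (piece s t a b) (1 - ?r, j)) ?g"
    by (rule decomposes_cut_piece) (use piece D in auto)
  moreover have "?g \<noteq> piece_value (s = t) (b + 1 - a)"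
  proof -
    \<comment> \<open>With only two rows, comparing \<open>?r\<close> and \<open>t\<close> with
      \<open>s\<close> also compares them with each other.\<close>
    have "(?r = t) = ((s = t) = (s = ?r))" using piece(2,3) by auto
    moreover have "b + 1 - j = (b + 1 - a) + 1 - ?k" using D by simp
    ultimately have "?g \<in> (\<lambda>(f, i). piece_value f i XOR piece_value ((s = t) = f) (b + 1 - a + 1 - i))
        ` (UNIV \<times> {3..b + 1 - a - 2})"
      using D by (intro image_eqI[where x = "(s = ?r, ?k)"]) auto
    then show ?thesis
      using mex_notin[OF finite_piece_followers] piece_value.simps by metis
  qed
  ultimately show ?case
    using D by (auto simp: v)
next
  case (join a c W g b W' g')
  have "strip_move W v \<or> strip_move W' v"
    using strip_move_UnD join.prems decomposes_bounds[OF join.hyps(1)]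
      decomposes_bounds[OF join.hyps(2)] by blast
  moreover have "x XOR g' \<noteq> g XOR g'" if "x \<noteq> g" for x
    using that by (metis xor.assoc xor_self_eq xor.right_neutral)
  moreover have "g XOR x \<noteq> g XOR g'" if "x \<noteq> g'" for x
    using that by (metis xor.assoc xor_self_eq xor.left_neutral)
  ultimately show ?case
    using join.IH decomposes_join_switch[OF join.hyps] by meson
qed

lemma decomposes_less:
  assumes "decomposes a b W g" "n < g"
  shows "\<exists>v. strip_move W v \<and> decomposes a b (strip_switch W v) n"
  using assms
proof (induction arbitrary: n rule: decomposes.induct)
  case (piece a b s t)
  have "n \<in> (\<lambda>(f, i). piece_value f i XOR piece_value ((s = t) = f) (b + 1 - a + 1 - i))
        ` (UNIV \<times> {3..b + 1 - a - 2})"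
    using piece(4) by (subst (asm) piece_value.simps) (rule less_mexD)
  then obtain f k where k: "3 \<le> k" "k \<le> b + 1 - a - 2"
    and n: "n = piece_value f k XOR piece_value ((s = t) = f) (b + 1 - a + 1 - k)"
    by auto
  have rows: "s = 0 \<or> s = 1" "t = 0 \<or> t = 1"
    using piece(2,3) by auto
  \<comment> \<open>Block columns are numbered from 1, starting at \<open>a\<close>.\<close>
  define j where "j = a + k - 1"
  have j: "a + 2 \<le> j" "j + 2 \<le> b" "j + 1 - a = k" "b + 1 - a + 1 - k = b + 1 - j"
    using k by (auto simp: j_def)
  obtain r where r: "r \<le> 1" "\<not> (b = a + 4 \<and> s = t \<and> r = s)"
    "n = piece_value (s = r) k XOR piece_value (r = t) (b + 1 - j)"
  proof (cases "b = a + 4 \<and> s = t \<and> f")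
    case True
    \<comment> \<open>This cut of \<open>H 5\<close> is illegal, but both cuts of \<open>H 5\<close> have value 0.\<close>
    then have "k = 3" "b + 1 - j = 3" "n = 0" using k n by (auto simp: j_def)
    then show ?thesis
      using True rows by (intro that[of "1 - s"]) auto
  next
    case False
    define r where "r = (if f then s else 1 - s)"
    have r: "r \<le> 1" "(s = r) = f" "(r = t) = ((s = t) = f)"
      using rows by (auto simp: r_def)
    show ?thesis
    proof (rule that)
      show "\<not> (b = a + 4 \<and> s = t \<and> r = s)"
        using False r(2) by metis
      show "n = piece_value (s = r) k XOR piece_value (r = t) (b + 1 - j)"
        unfolding r n j(4) ..
    qed (fact r(1))
  qed
  show ?case
    using piece_switch(1)[OF piece(2,3) r(1) j(1,2) r(2)]
      decomposes_cut_piece[OF piece(2,3) r(1) j(1,2) r(2)] r(3) j(3) by auto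
next
  case (join a c W g b W' g')
  \<comment> \<open>To reach \<open>n\<close> overall, one side must reach \<open>n\<close> XOR the
    value of the other.\<close>
  have eqs: "(n XOR g') XOR g' = n" "g XOR (n XOR g) = n"
    by (metis xor.assoc xor.commute xor_self_eq xor.right_neutral)+
  from less_xor_cases[OF join.prems] show ?case
  proof
    assume "n XOR g' < g"
    then obtain v where v: "strip_move W v" "decomposes a c (strip_switch W v) (n XOR g')"
      using join.IH(1) by blast
    show ?thesis
      using strip_move_Un[OF v(1)] decomposes_join_switch(1)[OF join.hyps v(2)] eqs(1)
      by (intro exI[of _ v]) simp
  next
    assume "n XOR g < g'"
    then obtain v where v: "strip_move W' v" "decomposes c b (strip_switch W' v) (n XOR g)"
      using join.IH(2) by blast
    show ?thesis
      using strip_move_Un[OF v(1), of W] decomposes_join_switch(2)[OF join.hyps v(2)] eqs(2)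
      by (intro exI[of _ v]) (simp add: Un_commute)
  qed
qed

section \<open>Agreement of grid and strip away from the end columns\<close>

lemma closed_nbhd_grid:
  assumes "i \<le> 1" "1 < j" "j < m"
  shows "closed_nbhd (grid_position m Z) (i, j) = strip_nbhd (i, j)"
proof -
  obtain k where j: "j = Suc k" using assms(2) by (cases j) auto
  have "p \<in> closed_nbhd (grid_position m Z) (i, j) \<longleftrightarrow> p \<in> strip_nbhd (i, j)" for p
  proof -
    obtain x y where p: "p = (x, y)" by fastforce
    have "{(x, y), (i, j)} \<in> grid_edges m \<longleftrightarrow>
      x \<le> 1 \<and> 1 \<le> y \<and> y \<le> m \<and> (x = 1 - i \<and> y = j \<or> x = i \<and> (y = j + 1 \<or> j = y + 1))"
    proof -
      have vertical: "(\<exists>k. {(x, y), (i, j)} = {(0, k), (1, k)} \<and> 1 \<le> k \<and> k \<le> m) \<longleftrightarrow> x = 1 - i \<and> y = j"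
        using assms by (auto simp: doubleton_eq_iff)
      have horizontal: "(\<exists>h k. {(x, y), (i, j)} = {(h, k), (h, k + 1)} \<and> h \<le> 1 \<and> 1 \<le> k \<and> k < m) \<longleftrightarrow>
          x = i \<and> 1 \<le> y \<and> (y = j + 1 \<or> j = y + 1)"
        unfolding doubleton_eq_iff prod.inject using assms by presburger
      show ?thesis
        unfolding grid_edges_def Un_iff mem_Collect_eq vertical horizontal using assms by auto
    qed
    then show ?thesis
      using assms unfolding p closed_nbhd_def strip_nbhd_def
      by (auto simp: grid_position_def grid_verts_def j)
  qed
  then show ?thesis by blast
qed

lemma legal_move_grid:
  assumes "W \<subseteq> {..1} \<times> {1<..<m}"
  shows "legal_move (grid_position m (grid_verts m - W)) v \<longleftrightarrow> strip_move W v"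
proof (cases "v \<in> W")
  case False
  then show ?thesis
    by (auto simp: legal_move_def strip_move_def weight_def grid_position_def split: if_splits)
next
  case True
  obtain i j where v: "v = (i, j)" by fastforce
  have ij: "i \<le> 1" "1 < j" "j < m" using True assms v by auto
  let ?S = "grid_position m (grid_verts m - W)"
  have nbhd: "closed_nbhd ?S (i, j) = {(i, j), (1 - i, j), (i, j - 1), (i, j + 1)}"
    using closed_nbhd_grid[OF ij] by (simp add: strip_nbhd_def)
  have verts: "(i, j) \<in> grid_verts m" "(1 - i, j) \<in> grid_verts m" "(i, j - 1) \<in> grid_verts m"
    "(i, j + 1) \<in> grid_verts m"
    using ij by (auto simp: grid_verts_def)
  have distinct: "i \<noteq> 1 - i" "1 - i \<noteq> i" "j \<noteq> j - 1" "j - 1 \<noteq> j + 1"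
    using ij by presburger+
  have weights: "weight ?S u = of_bool (u \<in> W)"
    "weight (switch ?S (i, j)) u = of_bool (u \<notin> W)" if "u \<in> closed_nbhd ?S (i, j)" for u
    using that nbhd verts by (auto simp: weight_def switch_def grid_position_def)
  have "sigma ?S (i, j) = (\<Sum>u\<in>closed_nbhd ?S (i, j). of_bool (u \<in> W))"
    "sigma (switch ?S (i, j)) (i, j) = (\<Sum>u\<in>closed_nbhd ?S (i, j). of_bool (u \<notin> W))"
    by (simp_all add: sigma_def weights)
  moreover have "weight ?S (i, j) = 1" "(i, j) \<in> verts ?S"
    using True v verts by (auto simp: weight_def grid_position_def)
  ultimately show ?thesis
    using True distinct unfolding v legal_move_def nbhd
    by (auto simp: strip_move_def of_bool_def simp del: sum_of_bool_eq split: if_splits)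
qed

lemma switch_grid:
  assumes "W \<subseteq> {..1} \<times> {1<..<m}" "v \<in> W"
  shows "switch (grid_position m (grid_verts m - W)) v
    = grid_position m (grid_verts m - strip_switch W v)"
proof -
  obtain i j where v: "v = (i, j)" by fastforce
  have ij: "i \<le> 1" "1 < j" "j < m" using assms v by auto
  have "strip_nbhd v \<subseteq> grid_verts m" "W \<subseteq> grid_verts m"
    using ij assms(1) by (auto simp: v strip_nbhd_def grid_verts_def)
  moreover have "closed_nbhd (grid_position m (grid_verts m - W)) v = strip_nbhd v"
    using closed_nbhd_grid[OF ij] v by simp
  ultimately show ?thesis
    unfolding switch_def by (auto simp: grid_position_def strip_switch_def)
qed

text \<open>Induction along the game tree: the values of followers are read off their
  decompositions, so the two mex conditions determine the nimber.\<close>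

lemma grundy_eq_decomposition_value:
  "decomposes 1 m W g \<Longrightarrow> grundy (grid_position m (grid_verts m - W)) = g"
proof (induction "grid_position m (grid_verts m - W)" arbitrary: W g rule: grundy.induct)
  case 1
  let ?S = "grid_position m (grid_verts m - W)"
  have W: "W \<subseteq> {..1} \<times> {1<..<m}" using decomposes_bounds[OF 1(2)] by blast
  have toggle: "toggle_position ?S"
    using simple_graph_grid[of m] by (simp add: toggle_position_def grid_position_def)
  have in_W: "v \<in> W" if "strip_move W v" for v
    using that by (auto simp: strip_move_def)
  have followers: "followers ?S = {grid_position m (grid_verts m - strip_switch W v) | v. strip_move W v}"
    unfolding followers_def using legal_move_grid[OF W] switch_grid[OF W] in_W by metis
  have IH: "grundy (grid_position m (grid_verts m - strip_switch W v)) = h"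
    if "strip_move W v" "decomposes 1 m (strip_switch W v) h" for v h
    using 1(1)[OF toggle _ that(2)] that(1) followers by blast
  have "g \<notin> grundy ` followers ?S"
    unfolding followers using IH decomposes_moveD[OF 1(2)] by fastforce
  moreover have "n \<in> grundy ` followers ?S" if "n < g" for n
    unfolding followers using IH decomposes_less[OF 1(2) that] by blast
  ultimately show ?case
    using toggle by (simp add: grundy.simps[of ?S] mex_eqI)
qed

section \<open>Values of \<open>D\<close> and \<open>H\<close>\<close>

lemma grundy_D:
  assumes "m \<ge> 3"
  shows "grundy (D m) = piece_value False m"
proof -
  have "D m = grid_position m (grid_verts m - piece 0 1 1 m)"
    unfolding D_def
    by (rule arg_cong[where f = "grid_position m"])
      (use assms in \<open>auto simp: grid_verts_def piece_def split: if_splits\<close>)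
  then show ?thesis
    using grundy_eq_decomposition_value[OF decomposes.piece[of 1 m 0 1]] assms by simp
qed

lemma grundy_H:
  assumes "m \<ge> 3"
  shows "grundy (H m) = piece_value True m"
proof -
  have "grid_verts m - piece 0 0 1 m = (if m = 3 then {(0, 1), (0, 3), (1, 1), (1, 3)}
      else {(0, 1), (0, m), (1, 1), (1, 2), (1, m - 1), (1, m)})"
  proof (cases "m = 3")
    case True
    then show ?thesis by (auto simp: grid_verts_def piece_def)
  next
    case False
    then have "p \<in> grid_verts m - piece 0 0 1 m \<longleftrightarrow>
        p \<in> {(0, 1), (0, m), (1, 1), (1, 2), (1, m - 1), (1, m)}" for p
      using assms by (cases p; cases "fst p = 0"; cases "fst p = 1")
        (simp add: grid_verts_def piece_def; presburger)+
    from set_eqI[OF this] show ?thesis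
      using False by (simp only: if_False)
  qed
  then have "H m = grid_position m (grid_verts m - piece 0 0 1 m)"
    by (simp only: H_def)
  then show ?thesis
    using grundy_eq_decomposition_value[OF decomposes.piece[of 1 m 0 0]] assms by simp
qed

theorem proposition3p4:
  fixes m :: nat
  assumes "m \<ge> 3"
  shows "grundy (D m) = mex ((\<lambda>i. grundy (H i) XOR grundy (D (m + 1 - i))) ` {3..m - 2})"
proof -
  let ?h = "\<lambda>i. piece_value True i XOR piece_value False (m + 1 - i)"
  let ?o = "\<lambda>(f, i). piece_value f i XOR piece_value (False = f) (m + 1 - i)"
  \<comment> \<open>A cut of \<open>D\<close> leaves one \<open>H\<close> and one \<open>D\<close>
    in either order; the reflection of \<open>i\<close> to \<open>m + 1 - i\<close> exchanges the
    orders, so one order gives all values.\<close>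
  have "?o ` (UNIV \<times> {3..m - 2}) = ?h ` {3..m - 2}"
  proof (intro set_eqI iffI)
    fix x assume "x \<in> ?o ` (UNIV \<times> {3..m - 2})"
    then obtain f i where i: "i \<in> {3..m - 2}" and x: "x = ?o (f, i)" by blast
    show "x \<in> ?h ` {3..m - 2}"
    proof (cases f)
      case True
      then show ?thesis using i x by auto
    next
      case False
      then have "x = ?h (m + 1 - i)" using i x by (auto simp: xor.commute)
      moreover have "m + 1 - i \<in> {3..m - 2}" using i by auto
      ultimately show ?thesis by blast
    qed
  next
    fix x assume "x \<in> ?h ` {3..m - 2}"
    then obtain i where "i \<in> {3..m - 2}" and "x = ?h i" by blast
    then show "x \<in> ?o ` (UNIV \<times> {3..m - 2})"
      by (intro image_eqI[where x = "(True, i)"]) auto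
  qed
  moreover have "?h ` {3..m - 2} = (\<lambda>i. grundy (H i) XOR grundy (D (m + 1 - i))) ` {3..m - 2}"
    by (intro image_cong) (auto simp: grundy_D grundy_H)
  ultimately show ?thesis
    using assms by (simp add: grundy_D piece_value.simps[of False m])
qed

end
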